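(* Let $G(V,E)$ be an eulerian graph with an even number of edges. If $\frac{|E|}{2}$ is odd, then $G$ is not balanceable.
   Context: All graphs are simple and finite. A graph is eulerian if all its vertices have even degree (connectedness is not required). A 2-coloring of the edges of $K_n$ is a function $\alpha:E(K_n)\to\{R,B\}$. It contains a balanced copy of a graph $G$ if $K_n$ has a (not necessarily induced) subgraph isomorphic to $G$ whose edge set is partitioned into $E_1,E_2$ with $\alpha(e)=R$ for $e\in E_1$, $\alpha(e)=B$ for $e\in E_2$, and $\big||E_1|-|E_2|\big|\le 1$. A graph $G$ is balanceable if there is an $n_0$ such that for every $n\ge n_0$ there exists an integer $m$ with $0\le m<\lfloor \frac12\binom n2\rfloor$ such that every 2-coloring $\alpha$ of $E(K_n)$ with $|\alpha^{-1}(R)|>m$ and $|\alpha^{-1}(B)|>m$ contains a balanced copy of $G$. *)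

theory Defs
  imports Main "HOL-Library.Ramsey"
begin

text \<open>
  A graph is a pair \<open>(V, E)\<close> of a vertex set and a set of two-element subsets of \<open>V\<close>;
  \<open>nsets V 2\<close> is the set of all two-element subsets of \<open>V\<close>.
\<close>

type_synonym 'a graph = "'a set \<times> 'a set set"

definition simple_graph :: "'a graph \<Rightarrow> bool" where
  "simple_graph G \<longleftrightarrow> finite (fst G) \<and> snd G \<subseteq> nsets (fst G) 2"

definition degree :: "'a graph \<Rightarrow> 'a \<Rightarrow> nat" where
  "degree G v = card {e \<in> snd G. v \<in> e}"

definition eulerian :: "'a graph \<Rightarrow> bool" where
  "eulerian G \<longleftrightarrow> (\<forall>v \<in> fst G. even (degree G v))"

definition subgraph :: "'a graph \<Rightarrow> 'a graph \<Rightarrow> bool" where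
  "subgraph H G \<longleftrightarrow> simple_graph H \<and> fst H \<subseteq> fst G \<and> snd H \<subseteq> snd G"

definition isomorphic :: "'a graph \<Rightarrow> 'b graph \<Rightarrow> bool" where
  "isomorphic G H \<longleftrightarrow> (\<exists>f. bij_betw f (fst G) (fst H) \<and>
     (\<forall>u \<in> fst G. \<forall>v \<in> fst G. {u, v} \<in> snd G \<longleftrightarrow> {f u, f v} \<in> snd H))"

definition complete_graph :: "nat \<Rightarrow> nat graph" where
  "complete_graph n = ({..<n}, nsets {..<n} 2)"

datatype color = Red | Blue

text \<open>
  A 2-coloring of the edges of \<open>complete_graph n\<close> is represented by a total function on sets;
  its values outside the edge set are never looked at.
\<close>

definition color_class :: "nat \<Rightarrow> (nat set \<Rightarrow> color) \<Rightarrow> color \<Rightarrow> nat set set" where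
  "color_class n \<alpha> c = {e \<in> snd (complete_graph n). \<alpha> e = c}"

definition contains_balanced_copy :: "nat \<Rightarrow> (nat set \<Rightarrow> color) \<Rightarrow> 'a graph \<Rightarrow> bool" where
  "contains_balanced_copy n \<alpha> G \<longleftrightarrow>
     (\<exists>H E1 E2. subgraph H (complete_graph n) \<and> isomorphic G H \<and>
        snd H = E1 \<union> E2 \<and> E1 \<inter> E2 = {} \<and>
        (\<forall>e \<in> E1. \<alpha> e = Red) \<and> (\<forall>e \<in> E2. \<alpha> e = Blue) \<and>
        \<bar>int (card E1) - int (card E2)\<bar> \<le> 1)"

definition balanceable :: "'a graph \<Rightarrow> bool" where
  "balanceable G \<longleftrightarrow>
     (\<exists>n0. \<forall>n \<ge> n0. \<exists>m < (n choose 2) div 2. \<forall>\<alpha>.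
        card (color_class n \<alpha> Red) > m \<and> card (color_class n \<alpha> Blue) > m \<longrightarrow>
        contains_balanced_copy n \<alpha> G)"

end

theory Submission
  imports Defs
begin

text \<open>
  Colour the edges of a cut of \<open>K\<^sub>n\<close> red and all other edges blue. A cut meets every copy of an
  eulerian graph in an even number of edges, so no copy of \<open>G\<close> has exactly the odd number
  \<open>|E| / 2\<close> of red edges. If \<open>n = (k + 1)\<^sup>2\<close>, the cut with sides \<open>k (k + 1) / 2\<close> and \<open>(k + 1) (k + 2) / 2\<close>
  has exactly half of the edges of \<open>K\<^sub>n\<close>, so this colouring defeats every admissible \<open>m\<close>.
\<close>

text \<open>Double counting of incidences between \<open>V \<inter> A\<close> and \<open>E\<close>:
  the degrees of the vertices in \<open>A\<close> sum to an even number, and the same sum is that of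
  \<open>card (e \<inter> A)\<close> over all edges. A sum is even exactly when it has an even
  number of odd terms.\<close>

lemma eulerian_even_cut:
  assumes "simple_graph (V, E)" and "eulerian (V, E)"
  shows "even (card {e \<in> E. odd (card (e \<inter> A))})"
proof -
  have fin: "finite V" and sub: "E \<subseteq> nsets V 2"
    using assms(1) by (auto simp: simple_graph_def)
  then have finE: "finite E"
    by (meson finite_imp_finite_nsets finite_subset)
  have "(\<Sum>v \<in> V \<inter> A. degree (V, E) v) = (\<Sum>v \<in> V \<inter> A. \<Sum>e \<in> E. if v \<in> e then 1 else 0)"
    using finE by (intro sum.cong) (simp_all add: degree_def sum.If_cases Int_def)
  also have "\<dots> = (\<Sum>e \<in> E. \<Sum>v \<in> V \<inter> A. if v \<in> e then 1 else 0)"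
    by (rule sum.swap)
  also have "\<dots> = (\<Sum>e \<in> E. card (e \<inter> A))"
  proof (rule sum.cong)
    fix e assume "e \<in> E"
    then have "V \<inter> A \<inter> e = e \<inter> A"
      using sub by (auto simp: nsets_def)
    then show "(\<Sum>v \<in> V \<inter> A. if v \<in> e then 1 else 0) = card (e \<inter> A)"
      using fin by (simp add: sum.If_cases)
  qed simp
  finally have "even (\<Sum>e \<in> E. card (e \<inter> A))"
    using assms(2) by (metis (no_types, lifting) Int_iff dvd_sum eulerian_def fst_conv)
  then show ?thesis
    using finE by (simp add: even_sum_iff)
qed

text \<open>Isomorphism is defined through pairs of vertices; this turns it into a bijection of edge
  sets, so that edges can be counted on either side.\<close>

lemma bij_betw_edges:
  assumes G: "E \<subseteq> nsets V 2" and H: "F \<subseteq> nsets W 2"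
    and f: "bij_betw f V W"
    and edges: "\<And>u v. u \<in> V \<Longrightarrow> v \<in> V \<Longrightarrow> {u, v} \<in> E \<longleftrightarrow> {f u, f v} \<in> F"
  shows "bij_betw ((`) f) E F"
proof (rule bij_betw_imageI)
  have "E \<subseteq> Pow V"
    using G by (auto simp: nsets_def)
  then show "inj_on ((`) f) E"
    using f by (meson bij_betw_imp_inj_on inj_on_image_Pow inj_on_subset)
  show "(`) f ` E = F"
  proof (intro equalityI subsetI)
    fix e' assume "e' \<in> (`) f ` E"
    then obtain e where e: "e \<in> E" "e' = f ` e"
      by blast
    then have "e \<in> nsets V 2"
      using G by blast
    then obtain u v where "e = {u, v}" "u \<in> V" "v \<in> V"
      by (auto simp: nsets_def card_2_iff)
    then show "e' \<in> F"
      using e edges by simp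
  next
    fix e' assume e': "e' \<in> F"
    then have "e' \<in> nsets W 2"
      using H by blast
    then obtain x y where xy: "e' = {x, y}" "x \<in> W" "y \<in> W"
      by (auto simp: nsets_def card_2_iff)
    then obtain u v where "u \<in> V" "v \<in> V" "x = f u" "y = f v"
      using f by (metis bij_betw_imp_surj_on imageE)
    then show "e' \<in> (`) f ` E"
      using edges[of u v] e' xy by (auto intro!: image_eqI[of _ _ "{u, v}"])
  qed
qed

definition cut_coloring :: "nat set \<Rightarrow> nat set \<Rightarrow> color" where
  \<comment> \<open>An edge has two ends, so an odd intersection means that exactly one end lies in
    \<open>A\<close>: red edges are those of the cut. Stating this by parity matches
    \<open>eulerian_even_cut\<close>.\<close>
  "cut_coloring A e = (if odd (card (e \<inter> A)) then Red else Blue)"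

lemma cut_coloring_no_balanced_copy:
  assumes simple: "simple_graph (V, E)" and eul: "eulerian (V, E)"
    and even: "even (card E)" and odd: "odd (card E div 2)"
  shows "\<not> contains_balanced_copy n (cut_coloring A) (V, E)"
proof
  assume "contains_balanced_copy n (cut_coloring A) (V, E)"
  then obtain W F E1 E2 f where H: "simple_graph (W, F)"
    and f: "bij_betw f V W"
    and edges: "\<And>u v. u \<in> V \<Longrightarrow> v \<in> V \<Longrightarrow> {u, v} \<in> E \<longleftrightarrow> {f u, f v} \<in> F"
    and F: "F = E1 \<union> E2" "E1 \<inter> E2 = {}"
    and red: "\<forall>e \<in> E1. cut_coloring A e = Red"
    and blue: "\<forall>e \<in> E2. cut_coloring A e = Blue"
    and bal: "\<bar>int (card E1) - int (card E2)\<bar> \<le> 1"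
    unfolding contains_balanced_copy_def isomorphic_def subgraph_def by auto
  have subE: "E \<subseteq> nsets V 2" and subF: "F \<subseteq> nsets W 2" and "finite W"
    using simple H by (auto simp: simple_graph_def)
  then have "finite F"
    by (meson finite_imp_finite_nsets finite_subset)
  have bij: "bij_betw ((`) f) E F"
    using bij_betw_edges[OF subE subF f edges] .
  have "card F = card E1 + card E2"
    using F \<open>finite F\<close> by (simp add: card_Un_disjoint)
  \<comment> \<open>The two sizes add up to the even number \<open>card E\<close>, so their
    difference is even; being at most 1 in absolute value, it is 0.\<close>
  then have half: "card E1 = card E div 2"
    using bij_betw_same_card[OF bij] bal even by presburger
  have card_eq: "card (f ` e \<inter> A) = card (e \<inter> f -` A)" if "e \<in> E" for e
  proof -
    have "inj_on f (e \<inter> f -` A)"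
      using that subE f by (auto simp: nsets_def bij_betw_def intro: inj_on_subset)
    moreover have "f ` e \<inter> A = f ` (e \<inter> f -` A)"
      by auto
    ultimately show ?thesis
      by (simp add: card_image)
  qed
  have "E1 = {e \<in> F. odd (card (e \<inter> A))}"
    using F red blue by (fastforce simp: cut_coloring_def split: if_splits)
  also have "\<dots> = (`) f ` {e \<in> E. odd (card (e \<inter> f -` A))}"
    using card_eq bij_betw_imp_surj_on[OF bij, symmetric] by auto
  finally have "card E1 = card {e \<in> E. odd (card (e \<inter> f -` A))}"
    using bij by (simp add: card_image bij_betw_def inj_on_def)
  then show False
    using eulerian_even_cut[OF simple eul] half odd by simp
qed

lemma card_cut_coloring_Red:
  assumes "a \<le> n"
  shows "card (color_class n (cut_coloring {..<a}) Red) = a * (n - a)"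
proof -
  let ?g = "\<lambda>(x, y). {x, y :: nat}"
  have "color_class n (cut_coloring {..<a}) Red = ?g ` ({..<a} \<times> {a..<n})"
  proof (intro equalityI subsetI)
    fix e assume "e \<in> color_class n (cut_coloring {..<a}) Red"
    then have "e \<in> nsets {..<n} 2" and odd: "odd (card (e \<inter> {..<a}))"
      by (auto simp: color_class_def complete_graph_def cut_coloring_def split: if_splits)
    \<comment> \<open>As the side of the cut is an initial segment, ordering the ends forces the
      smaller one to be the end inside it.\<close>
    then obtain x y where e: "e = {x, y}" "x < y" "y < n"
      by (auto simp: nsets_def card_2_iff) (metis insert_commute linorder_neqE_nat)
    have "x < a" "a \<le> y"
      using odd e by (auto simp: Int_insert_left split: if_splits)
    then show "e \<in> ?g ` ({..<a} \<times> {a..<n})"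
      using e by auto
  next
    fix e assume "e \<in> ?g ` ({..<a} \<times> {a..<n})"
    then obtain x y where "e = {x, y}" "x < a" "a \<le> y" "y < n"
      by auto
    then show "e \<in> color_class n (cut_coloring {..<a}) Red"
      by (auto simp: color_class_def complete_graph_def cut_coloring_def nsets_def)
  qed
  moreover have "inj_on ?g ({..<a} \<times> {a..<n})"
    by (auto simp: inj_on_def doubleton_eq_iff)
  ultimately show ?thesis
    by (simp add: card_image card_cartesian_product)
qed

lemma card_color_class_add:
  "card (color_class n \<alpha> Red) + card (color_class n \<alpha> Blue) = n choose 2"
proof -
  have "color_class n \<alpha> Red \<union> color_class n \<alpha> Blue = nsets {..<n} 2"
    by (auto simp: color_class_def complete_graph_def intro: color.exhaust)
  moreover have "color_class n \<alpha> Red \<inter> color_class n \<alpha> Blue = {}"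
    by (auto simp: color_class_def)
  moreover have "finite (color_class n \<alpha> c)" for c
    by (simp add: color_class_def complete_graph_def finite_imp_finite_nsets)
  ultimately show ?thesis
    by (metis card_Un_disjoint card_lessThan card_nsets)
qed

lemma cut_coloring_halves_square:
  fixes k :: nat
  defines "n \<equiv> (k + 1) * (k + 1)" and "\<alpha> \<equiv> cut_coloring {..<k * (k + 1) div 2}"
  shows "card (color_class n \<alpha> Red) = (n choose 2) div 2"
    and "card (color_class n \<alpha> Blue) = (n choose 2) div 2"
proof -
  define a where "a = k * (k + 1) div 2"
  have a: "2 * a = k * (k + 1)"
    unfolding a_def by simp
  then have "2 * n = 2 * a + (k + 1) * (k + 2)"
    unfolding n_def by (simp add: algebra_simps)
  then have le: "a \<le> n" and na: "2 * (n - a) = (k + 1) * (k + 2)"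
    using a by auto
  \<comment> \<open>The factor 4 clears both halves: the product is
    \<open>k * (k + 1) * (k + 1) * (k + 2)\<close>, where \<open>(k + 1) * (k + 1) = n\<close> and
    \<open>k * (k + 2) = n - 1\<close>.\<close>
  have "4 * (a * (n - a)) = (2 * a) * (2 * (n - a))"
    by simp
  also have "\<dots> = n * (n - 1)"
    unfolding a na by (simp add: n_def algebra_simps)
  finally have "n choose 2 = 2 * (a * (n - a))"
    by (simp add: choose_two)
  moreover have "card (color_class n \<alpha> Red) = a * (n - a)"
    using card_cut_coloring_Red[OF le] by (simp add: \<alpha>_def a_def)
  ultimately show "card (color_class n \<alpha> Red) = (n choose 2) div 2"
    and "card (color_class n \<alpha> Blue) = (n choose 2) div 2"
    using card_color_class_add[of n \<alpha>] by simp_all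
qed

theorem proposition7:
  fixes V :: "'a set" and E :: "'a set set"
  assumes "simple_graph (V, E)"
    and "eulerian (V, E)"
    and "even (card E)"
    and "odd (card E div 2)"
  shows "\<not> balanceable (V, E)"
proof
  assume "balanceable (V, E)"
  then obtain k where k: "\<forall>n \<ge> k. \<exists>m < (n choose 2) div 2. \<forall>\<alpha>.
      card (color_class n \<alpha> Red) > m \<and> card (color_class n \<alpha> Blue) > m \<longrightarrow>
      contains_balanced_copy n \<alpha> (V, E)"
    unfolding balanceable_def by blast
  \<comment> \<open>The threshold itself serves as the root of the square, which puts
    \<open>n\<close> beyond the threshold. Both classes then have \<open>(n choose 2) div 2\<close>
    edges, more than any allowed \<open>m\<close>.\<close>
  have "k \<le> (k + 1) * (k + 1)"
    by simp
  with k cut_coloring_halves_square[of k] show False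
    using cut_coloring_no_balanced_copy[OF assms] by metis
qed

end
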